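(* Let $d,d',a,t$ be positive integers with $t\ge 2$. Let $W=(A,V)$ with $A\in\mathbb{R}^{d\times d}$, $\mathrm{rk}(A)\le a$, and $V\in\mathbb{R}^{d'\times d}$, and let $\varphi_W\colon\mathbb{R}^{d\times t}\to\mathbb{R}^{d'\times t}$, $\varphi_W(X)=VXX^\top AX$. The fiber of $\varphi_W$, i.e. the set of all $W'=(A',V')$ with $A'\in\mathbb{R}^{d\times d}$, $\mathrm{rk}(A')\le a$, $V'\in\mathbb{R}^{d'\times d}$ and $\varphi_{W'}=\varphi_W$, is as follows: (1) If $\mathrm{rk}(A)=\mathrm{rk}(V)=1$, then, given decompositions $A=k\otimes q$ and $V=h\otimes v$ with $q,k,v\in\mathbb{R}^d\setminus\{0\}$ and $h\in\mathbb{R}^{d'}\setminus\{0\}$, the fiber consists exactly of the rescalings of $W=(k\otimes q,\,h\otimes v)$ and the rescalings of $(v\otimes q,\,h\otimes k)$. (2) If $\varphi_W=0$, the fiber consists of the pairs $(A',V')$ such that $A'=0$ or $V'=0$. (3) Otherwise, the fiber consists exactly of the rescalings of $W$.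
   Context: For vectors $u,w$, $u\otimes w$ denotes the rank-one matrix $uw^\top$. A rescaling of a pair $(A,V)$ is a pair $(\lambda A,\tfrac1\lambda V)$ with $\lambda\in\mathbb{R}\setminus\{0\}$. The map $\varphi_W$ is the (single-layer) lightning self-attention mechanism, parametrized by the attention matrix $A=K^\top Q$ (where $Q,K\in\mathbb{R}^{a\times d}$ are query and key weights, so that $\mathrm{rk}(A)\le a$) and the value weights $V$. The set of all such $\varphi_W$ is the neuromanifold $\mathcal{M}_{d,d',a}$. *)

theory Defs imports "HOL-Analysis.Analysis" begin

text \<open>Matrices of size \<open>m \<times> n\<close> have type \<^typ>\<open>real^'n^'m\<close>, i.e. the column index comes first.\<close>

text \<open>The rank-one matrix \<open>u \<otimes> w = u w\<^sup>T\<close>.\<close>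

definition outer :: "real^'m \<Rightarrow> real^'n \<Rightarrow> real^'n^'m"
  where "outer u w = (\<chi> i j. u $ i * w $ j)"

definition lightning :: "(real^'d^'d) \<times> (real^'d^'e) \<Rightarrow> real^'t^'d \<Rightarrow> real^'t^'e"
  where "lightning W X = (case W of (A, V) \<Rightarrow> V ** X ** transpose X ** A ** X)"

text \<open>\<open>A = K\<^sup>T Q\<close> with \<open>Q, K\<close> of size \<open>a \<times> d\<close> forces rank at most \<open>a\<close>; the parameter
  space is taken in terms of \<open>A\<close> rather than \<open>Q, K\<close>.\<close>

definition params :: "nat \<Rightarrow> ((real^'d^'d) \<times> (real^'d^'e)) set"
  where "params a = {(A, V). rank A \<le> a}"

definition fiber :: "nat \<Rightarrow> (real^'t^'d \<Rightarrow> real^'t^'e) \<Rightarrow> ((real^'d^'d) \<times> (real^'d^'e)) set"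
  where "fiber a f = {W \<in> params a. lightning W = f}"

definition rescalings :: "(real^'d^'d) \<times> (real^'d^'e) \<Rightarrow> ((real^'d^'d) \<times> (real^'d^'e)) set"
  where "rescalings W = (case W of (A, V) \<Rightarrow> {(l *\<^sub>R A, (1 / l) *\<^sub>R V) | l. l \<noteq> 0})"

end

theory Submission imports Defs begin

text \<open>Evaluating \<open>\<phi>\<^sub>W\<close> on matrices with at most two nonzero columns shows that \<open>\<phi>\<^sub>W\<close> determines,
  and is determined by, the products of linear forms \<open>y \<mapsto> (A x \<bullet> y) (V\<^sup>T w \<bullet> y)\<close> for all \<open>x\<close>, \<open>w\<close>.
  Such a product determines its factors up to order and reciprocal scaling. If for a single \<open>x\<close>
  with \<open>A x \<noteq> 0\<close>, or a single \<open>w\<close> with \<open>V\<^sup>T w \<noteq> 0\<close>, the factors are not swapped, cancelling the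
  common factor forces \<open>W'\<close> to be a rescaling of \<open>W\<close>. If they are always swapped, then all \<open>V\<^sup>T w\<close>
  lie on one line and so do all \<open>A x\<close>, so both matrices have rank one.\<close>

section \<open>Products of two linear forms and the recovery of their factors\<close>

text \<open>Taking \<open>y = a\<close> shows that \<open>a\<close> is zero or orthogonal to
  \<open>b\<close>; in the latter case \<open>y = a + b\<close> turns the product into that of the
  squared norms.\<close>

lemma linear_forms_mult_eq_0:
  fixes a b :: "'a::real_inner"
  assumes "\<And>y. (a \<bullet> y) * (b \<bullet> y) = 0"
  shows "a = 0 \<or> b = 0"
  using assms[of a] assms[of "a + b"]
  by (auto simp: inner_add_right inner_commute)

lemma linear_forms_cancel:
  fixes a b c :: "'a::real_inner"
  assumes "a \<noteq> 0" and "\<And>y. (a \<bullet> y) * (b \<bullet> y) = (a \<bullet> y) * (c \<bullet> y)"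
  shows "b = c"
  using linear_forms_mult_eq_0[of a "b - c"] assms
  by (auto simp: inner_diff_left right_diff_distrib)

text \<open>Unique factorization, by projecting \<open>c\<close> and \<open>d\<close> orthogonally
  to \<open>a\<close>: where \<open>a\<close> vanishes so does the product, which forces
  \<open>c\<close> or \<open>d\<close> to be a multiple of \<open>a\<close>. If it is
  \<open>d\<close>, cancelling \<open>a\<close> makes \<open>c\<close> a multiple of
  \<open>b\<close>.\<close>

lemma linear_forms_mult_eq:
  fixes a b c d :: "'a::real_inner"
  assumes "a \<noteq> 0" "b \<noteq> 0"
    and eq: "\<And>y. (a \<bullet> y) * (b \<bullet> y) = (c \<bullet> y) * (d \<bullet> y)"
  shows "(\<exists>l. c = l *\<^sub>R a) \<or> (\<exists>l. c = l *\<^sub>R b)"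
proof -
  define c1 where "c1 = c - ((c \<bullet> a) / (a \<bullet> a)) *\<^sub>R a"
  define d1 where "d1 = d - ((d \<bullet> a) / (a \<bullet> a)) *\<^sub>R a"
  have c: "c = ((c \<bullet> a) / (a \<bullet> a)) *\<^sub>R a + c1" and d: "d = ((d \<bullet> a) / (a \<bullet> a)) *\<^sub>R a + d1"
    by (simp_all add: c1_def d1_def)
  have perp: "a \<bullet> c1 = 0" "a \<bullet> d1 = 0"
    using assms(1) by (simp_all add: c1_def d1_def inner_diff_right inner_commute)
  have cc: "c \<bullet> c1 = c1 \<bullet> c1" "c \<bullet> d1 = c1 \<bullet> d1"
    by (subst c, simp add: inner_add_left perp)+
  have dd: "d \<bullet> c1 = d1 \<bullet> c1" "d \<bullet> d1 = d1 \<bullet> d1"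
    by (subst d, simp add: inner_add_left perp)+
  \<comment> \<open>At \<open>c1\<close> the equation makes \<open>c1\<close> zero or orthogonal to
    \<open>d1\<close>; at \<open>c1 + d1\<close> its right side is then the product of their squared
    norms.\<close>
  have "c1 = 0 \<or> d1 = 0"
    using eq[of c1] eq[of "c1 + d1"] perp cc dd
    by (auto simp: inner_add_right inner_commute)
  then show ?thesis
  proof
    assume "c1 = 0"
    then show ?thesis using c by auto
  next
    assume "d1 = 0"
    then obtain m where m: "d = m *\<^sub>R a" using d by auto
    have "b = m *\<^sub>R c"
      using assms(1) by (rule linear_forms_cancel) (simp add: eq m)
    moreover from this have "m \<noteq> 0" using assms(2) by auto
    ultimately have "c = (1 / m) *\<^sub>R b" by simp
    then show ?thesis by blast
  qed
qed

text \<open>One unswapped factor fixes both families: cancelling \<open>f x0\<close> relates every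
  \<open>g w\<close> to \<open>g' w\<close>, then cancelling \<open>g' w0\<close> relates every
  \<open>f' x\<close> to \<open>f x\<close>. That \<open>g w0\<close> is nonzero gives
  \<open>l \<noteq> 0\<close> and \<open>g' w0 \<noteq> 0\<close>.\<close>

lemma linear_forms_family_unswapped:
  fixes f f' :: "'x \<Rightarrow> 'a::real_inner" and g g' :: "'w \<Rightarrow> 'a"
  assumes eq: "\<And>x w y. (f x \<bullet> y) * (g w \<bullet> y) = (f' x \<bullet> y) * (g' w \<bullet> y)"
    and "f x0 \<noteq> 0" "f' x0 = l *\<^sub>R f x0" "g w0 \<noteq> 0"
  shows "l \<noteq> 0" "f' x = l *\<^sub>R f x" "g' w = (1 / l) *\<^sub>R g w"
proof -
  have g: "g w = l *\<^sub>R g' w" for w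
    using assms(2) by (rule linear_forms_cancel) (simp add: eq assms(3))
  then show l: "l \<noteq> 0" using assms(4) by fastforce
  show g': "g' w = (1 / l) *\<^sub>R g w" for w using g l by simp
  have "g' w0 \<noteq> 0" using g assms(4) by fastforce
  then show "f' x = l *\<^sub>R f x"
  proof (rule linear_forms_cancel)
    show "(g' w0 \<bullet> y) * (f' x \<bullet> y) = (g' w0 \<bullet> y) * (l *\<^sub>R f x \<bullet> y)" for y
      using eq[of x y w0] by (auto simp: g mult.commute)
  qed
qed

lemma linear_forms_family_eq:
  fixes f f' :: "'x \<Rightarrow> 'a::real_inner" and g g' :: "'w \<Rightarrow> 'a"
  assumes eq: "\<And>x w y. (f x \<bullet> y) * (g w \<bullet> y) = (f' x \<bullet> y) * (g' w \<bullet> y)"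
    and x0: "f x0 \<noteq> 0" and w0: "g w0 \<noteq> 0"
  shows "(\<exists>l. l \<noteq> 0 \<and> (\<forall>x. f' x = l *\<^sub>R f x) \<and> (\<forall>w. g' w = (1 / l) *\<^sub>R g w)) \<or>
    (\<exists>u v. range f \<subseteq> span {u} \<and> range g \<subseteq> span {v})"
proof -
  have eq': "(g w \<bullet> y) * (f x \<bullet> y) = (g' w \<bullet> y) * (f' x \<bullet> y)" for x w y
    using eq[of x y w] by (simp add: mult.commute)
  consider (f) l where "f' x0 = l *\<^sub>R f x0" | (g) l where "g' w0 = l *\<^sub>R g w0"
    | (swap) "\<nexists>l. f' x0 = l *\<^sub>R f x0" "\<nexists>l. g' w0 = l *\<^sub>R g w0" by blast
  then show ?thesis
  proof cases
    case f
    from linear_forms_family_unswapped[where f = f and f' = f' and g = g and g' = g', OF eq x0 f w0] show ?thesis by blast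
  next
    case g
    \<comment> \<open>The two families exchange roles here, so the scalar comes out
      inverted.\<close>
    from linear_forms_family_unswapped[where f = g and f' = g' and g = f and g' = f', OF eq' w0 g x0]
    have "l \<noteq> 0" "\<forall>w. g' w = l *\<^sub>R g w" "\<forall>x. f' x = (1 / l) *\<^sub>R f x" by blast+
    then show ?thesis by (intro disjI1 exI[of _ "1 / l"]) simp
  next
    case swap
    \<comment> \<open>Factorization gives a fixed vector as a multiple of a varying one; as the
      fixed one is nonzero, the relation can be inverted.\<close>
    have line: "u \<in> span {u'}" if "u' = l *\<^sub>R u" "u' \<noteq> 0" for u u' :: 'a and l
    proof -
      have "u = (1 / l) *\<^sub>R u'" using that by auto
      then show ?thesis by (metis span_base span_mul singletonI)
    qed
    \<comment> \<open>Not being a multiple of \<open>f x0\<close>, the vector \<open>f' x0\<close>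
      must be a multiple of each nonzero \<open>g w\<close>. It is itself nonzero because
      \<open>l = 0\<close> is excluded too.\<close>
    have "g w \<in> span {f' x0}" for w
    proof (cases "g w = 0")
      case False
      then obtain l where "f' x0 = l *\<^sub>R g w"
        using linear_forms_mult_eq[OF x0 False, of "f' x0" "g' w"] eq swap by blast
      moreover have "f' x0 \<noteq> 0" using swap(1) by (metis scaleR_zero_left)
      ultimately show ?thesis by (rule line)
    qed (simp add: span_zero)
    moreover have "f x \<in> span {g' w0}" for x
    proof (cases "f x = 0")
      case False
      then obtain l where "g' w0 = l *\<^sub>R f x"
        using linear_forms_mult_eq[OF w0 False, of "g' w0" "f' x"] eq' swap by blast
      moreover have "g' w0 \<noteq> 0" using swap(2) by (metis scaleR_zero_left)
      ultimately show ?thesis by (rule line)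
    qed (simp add: span_zero)
    ultimately show ?thesis by blast
  qed
qed

section \<open>The lightning map expressed by linear forms\<close>

text \<open>Uses that \<open>X ** transpose X\<close> is the sum of \<open>outer c c\<close> over
  the columns \<open>c\<close> of \<open>X\<close>.\<close>

lemma lightning_mult_vector:
  "lightning (A, V) X *v u =
    (\<Sum>s\<in>UNIV. ((A *v (X *v u)) \<bullet> column s X) *\<^sub>R (V *v column s X))"
proof -
  have "(transpose X *v p) $ s = p \<bullet> column s X" for p s
    by (simp add: matrix_vector_mult_def transpose_def column_def inner_vec_def mult.commute)
  then have "X *v (transpose X *v p) = (\<Sum>s\<in>UNIV. (p \<bullet> column s X) *\<^sub>R column s X)" for p
    by (simp add: matrix_mult_sum scalar_mult_eq_scaleR)
  then show ?thesis
    by (simp add: lightning_def matrix_vector_mul_assoc[symmetric]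
        linear_sum[OF matrix_vector_mul_linear] matrix_vector_mult_scaleR)
qed

lemma lightning_eq_iff:
  fixes A A' :: "real^'d^'d" and V V' :: "real^'d^'e"
  assumes "CARD('t) \<ge> 2"
  shows "(lightning (A, V) :: real^'t^'d \<Rightarrow> real^'t^'e) = lightning (A', V') \<longleftrightarrow>
    (\<forall>x w y. ((A *v x) \<bullet> y) * ((w v* V) \<bullet> y) = ((A' *v x) \<bullet> y) * ((w v* V') \<bullet> y))"
    (is "?L \<longleftrightarrow> ?R")
proof -
  \<comment> \<open>\<open>(w v* V) \<bullet> y\<close> equals \<open>w \<bullet> (V *v y)\<close>,
    so letting \<open>w\<close> vary recovers a vector identity.\<close>
  have "(\<forall>w. ((A *v x) \<bullet> y) * ((w v* V) \<bullet> y) = ((A' *v x) \<bullet> y) * ((w v* V') \<bullet> y)) \<longleftrightarrow>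
      ((A *v x) \<bullet> y) *\<^sub>R (V *v y) = ((A' *v x) \<bullet> y) *\<^sub>R (V' *v y)" for x y
    using vector_eq_ldot[of "((A *v x) \<bullet> y) *\<^sub>R (V *v y)" "((A' *v x) \<bullet> y) *\<^sub>R (V' *v y)"]
    by (simp add: dot_lmul_matrix)
  then have R: "?R \<longleftrightarrow>
      (\<forall>x y. ((A *v x) \<bullet> y) *\<^sub>R (V *v y) = ((A' *v x) \<bullet> y) *\<^sub>R (V' *v y))"
    by meson
  show ?thesis
  proof
    assume ?R
    then have "lightning (A, V) X *v u = lightning (A', V') X *v u"
      for X :: "real^'t^'d" and u
      unfolding R by (simp add: lightning_mult_vector)
    then show ?L by (auto simp: fun_eq_iff matrix_eq)
  next
    assume L: ?L
    obtain j l :: 't where jl: "j \<noteq> l"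
      using assms card_le_Suc0_iff_eq[of "UNIV :: 't set"] by auto
    \<comment> \<open>Column \<open>j\<close> of the output for an input with columns
      \<open>x\<close> at \<open>j\<close>, \<open>y\<close> at \<open>l\<close> and zero elsewhere;
      this is where \<open>t \<ge> 2\<close> enters.\<close>
    have two: "((A *v x) \<bullet> x) *\<^sub>R (V *v x) + ((A *v x) \<bullet> y) *\<^sub>R (V *v y) =
      ((A' *v x) \<bullet> x) *\<^sub>R (V' *v x) + ((A' *v x) \<bullet> y) *\<^sub>R (V' *v y)" for x y
    proof -
      define X :: "real^'t^'d"
        where "X = (\<chi> i s. if s = j then x $ i else if s = l then y $ i else 0)"
      have col: "column s X = (if s = j then x else if s = l then y else 0)" for s
        by (auto simp: X_def column_def vec_eq_iff)
      have Xj: "X *v axis j 1 = x"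
        using col[of j] by (simp add: matrix_vector_mult_basis)
      have "lightning (B, U) X *v axis j 1 =
          ((B *v x) \<bullet> x) *\<^sub>R (U *v x) + ((B *v x) \<bullet> y) *\<^sub>R (U *v y)"
        for B :: "real^'d^'d" and U :: "real^'d^'e"
      proof -
        have "lightning (B, U) X *v axis j 1 =
            (\<Sum>s\<in>UNIV. ((B *v x) \<bullet> column s X) *\<^sub>R (U *v column s X))"
          by (simp add: lightning_mult_vector Xj)
        also have "\<dots> = (\<Sum>s\<in>{j, l}. ((B *v x) \<bullet> column s X) *\<^sub>R (U *v column s X))"
          by (rule sum.mono_neutral_right) (auto simp: col)
        finally show ?thesis using jl by (simp add: col)
      qed
      then show ?thesis using L by metis
    qed
    \<comment> \<open>The choice \<open>y = 0\<close> isolates the terms in \<open>x\<close> alone,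
      which then cancel.\<close>
    have "((A *v x) \<bullet> y) *\<^sub>R (V *v y) = ((A' *v x) \<bullet> y) *\<^sub>R (V' *v y)" for x y
      using two[of x y] two[of x 0] by simp
    then show ?R unfolding R by blast
  qed
qed

section \<open>Nonzero matrices, ranks and outer products\<close>

lemma transpose_0 [simp]: "transpose 0 = 0"
  by (simp add: transpose_def vec_eq_iff)

lemma matrix_vector_mult_nonzero:
  fixes A :: "real^'n^'m"
  assumes "A \<noteq> 0" obtains x where "A *v x \<noteq> 0"
  using assms matrix_eq[of A 0] by auto

lemma vector_matrix_mult_nonzero:
  fixes A :: "real^'n^'m"
  assumes "A \<noteq> 0" obtains w where "w v* A \<noteq> 0"
proof -
  have "transpose A \<noteq> 0"
    using assms by (metis transpose_transpose transpose_0)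
  then show thesis
    using that by (metis matrix_vector_mult_nonzero transpose_matrix_vector)
qed

lemma rank_eq_1_of_range_span:
  fixes A :: "real^'n^'m"
  assumes "A \<noteq> 0" "range ((*v) A) \<subseteq> span {u}"
  shows "rank A = 1"
proof -
  have "rank A \<le> 1"
    using dim_le_card[OF assms(2)] by (simp add: rank_dim_range)
  then show ?thesis using rank_eq_0[of A] assms(1) by linarith
qed

lemma outer_mult_vector: "outer u w *v x = (w \<bullet> x) *\<^sub>R u"
  by (simp add: vec_eq_iff outer_def matrix_vector_mult_def inner_vec_def sum_distrib_left
      sum_distrib_right mult_ac)

lemma vector_mult_outer: "x v* outer u w = (u \<bullet> x) *\<^sub>R w"
  by (simp add: vec_eq_iff outer_def vector_matrix_mult_def inner_vec_def sum_distrib_left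
      sum_distrib_right mult_ac)

lemma rank_outer_le: "rank (outer u w) \<le> 1"
proof -
  have "range ((*v) (outer u w)) \<subseteq> span {u}"
    by (auto simp: outer_mult_vector span_mul span_base)
  then show ?thesis
    using dim_le_card[of "range ((*v) (outer u w))" "{u}"] by (simp add: rank_dim_range)
qed

lemma rank_scaleR: "rank (c *\<^sub>R A) = rank A" if "c \<noteq> 0" for A :: "real^'n^'m"
proof -
  have "c *\<^sub>R A *v x = A *v (c *\<^sub>R x)" "A *v x = c *\<^sub>R A *v ((1 / c) *\<^sub>R x)" for x
    using that by (simp_all add: matrix_vector_mult_scaleR scaleR_matrix_vector_assoc)
  then have "range ((*v) (c *\<^sub>R A)) = range ((*v) A)"
    by (metis (no_types, lifting) image_subset_iff rangeI subset_antisym)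
  then show ?thesis by (simp add: rank_dim_range)
qed

section \<open>Rescalings and the zero map\<close>

text \<open>Takes its premises in the form in which \<open>linear_forms_family_unswapped\<close>
  delivers them. The action on row vectors determines \<open>transpose V'\<close>, hence
  \<open>V'\<close>.\<close>

lemma rescalingsI:
  assumes "l \<noteq> 0" "\<And>x. A' *v x = l *\<^sub>R (A *v x)" "\<And>w. w v* V' = (1 / l) *\<^sub>R (w v* V)"
  shows "(A', V') \<in> rescalings (A, V)"
proof -
  have "A' = l *\<^sub>R A"
    by (simp add: matrix_eq assms(2) scaleR_matrix_vector_assoc)
  moreover have "transpose V' = transpose ((1 / l) *\<^sub>R V)"
    by (simp add: matrix_eq assms(3) vector_scaleR_matrix_ac)
  then have "V' = (1 / l) *\<^sub>R V" by (metis transpose_transpose)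
  ultimately show ?thesis using assms(1) by (auto simp: rescalings_def)
qed

lemma rescalings_subset_fiber:
  fixes A :: "real^'d^'d" and V :: "real^'d^'e" and phi :: "real^'t^'d \<Rightarrow> real^'t^'e"
  assumes "(A, V) \<in> fiber a phi" and "CARD('t) \<ge> 2"
  shows "rescalings (A, V) \<subseteq> fiber a phi"
proof
  fix W assume "W \<in> rescalings (A, V)"
  then obtain l where W: "W = (l *\<^sub>R A, (1 / l) *\<^sub>R V)" and l: "l \<noteq> 0"
    by (auto simp: rescalings_def)
  have "(lightning W :: real^'t^'d \<Rightarrow> real^'t^'e) = lightning (A, V)"
    unfolding W lightning_eq_iff[OF assms(2)]
    using l by (simp add: vector_scaleR_matrix_ac scaleR_matrix_vector_assoc[symmetric])
  then show "W \<in> fiber a phi"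
    using assms(1) l by (simp add: fiber_def params_def W rank_scaleR)
qed

text \<open>The zero map is the lightning map of \<open>(0, 0)\<close>, so the criterion by products
  applies; nonzero \<open>A\<close> and \<open>V\<close> would give two nonzero forms with zero
  product.\<close>

lemma lightning_eq_0_iff:
  fixes A :: "real^'d^'d" and V :: "real^'d^'e"
  assumes "CARD('t) \<ge> 2"
  shows "(lightning (A, V) :: real^'t^'d \<Rightarrow> real^'t^'e) = (\<lambda>X. 0) \<longleftrightarrow> A = 0 \<or> V = 0"
proof -
  have 0: "(lightning (0 :: real^'d^'d, 0 :: real^'d^'e) :: real^'t^'d \<Rightarrow> real^'t^'e) = (\<lambda>X. 0)"
    by (simp add: fun_eq_iff matrix_eq lightning_mult_vector)
  show ?thesis
    unfolding 0[symmetric] lightning_eq_iff[OF assms]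
  proof
    assume *: "\<forall>x w y. ((A *v x) \<bullet> y) * ((w v* V) \<bullet> y) =
      (((0 :: real^'d^'d) *v x) \<bullet> y) * ((w v* (0 :: real^'d^'e)) \<bullet> y)"
    show "A = 0 \<or> V = 0"
    proof (rule ccontr)
      assume "\<not> (A = 0 \<or> V = 0)"
      then obtain x w where "A *v x \<noteq> 0" "w v* V \<noteq> 0"
        by (metis matrix_vector_mult_nonzero vector_matrix_mult_nonzero)
      then show False
        using linear_forms_mult_eq_0[of "A *v x" "w v* V"] * by simp
    qed
  qed auto
qed

section \<open>The fiber in the rank-one, zero and generic cases\<close>

theorem theorem3p2:
  fixes a :: nat
    and A :: "real^'d^'d"
    and V :: "real^'d^'e"
    and phi :: "real^'t^'d \<Rightarrow> real^'t^'e"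
  assumes "a \<ge> 1" and "CARD('t) \<ge> 2"
    and "rank A \<le> a"
    and "phi = lightning (A, V)"
  shows "(rank A = 1 \<and> rank V = 1 \<longrightarrow>
            (\<forall>k q v h. k \<noteq> 0 \<and> q \<noteq> 0 \<and> v \<noteq> 0 \<and> h \<noteq> 0 \<and>
                A = outer k q \<and> V = outer h v \<longrightarrow>
              fiber a phi = rescalings (outer k q, outer h v) \<union> rescalings (outer v q, outer h k))) \<and>
         (phi = (\<lambda>X. 0) \<longrightarrow>
            fiber a phi = {(A', V') \<in> params a. A' = 0 \<or> V' = 0}) \<and>
         (\<not> (rank A = 1 \<and> rank V = 1) \<and> phi \<noteq> (\<lambda>X. 0) \<longrightarrow>
            fiber a phi = rescalings (A, V))"
proof (intro conjI impI allI)
  have fiber: "(A', V') \<in> fiber a phi \<longleftrightarrow> rank A' \<le> a \<and>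
      (\<forall>x w y. ((A *v x) \<bullet> y) * ((w v* V) \<bullet> y) = ((A' *v x) \<bullet> y) * ((w v* V') \<bullet> y))" for A' V'
    unfolding fiber_def params_def assms(4) using lightning_eq_iff[OF assms(2), of A V A' V']
    by auto
  have self: "(A, V) \<in> fiber a phi" using assms(3) by (simp add: fiber)
  {
    fix k q v h
    assume "k \<noteq> 0 \<and> q \<noteq> 0 \<and> v \<noteq> 0 \<and> h \<noteq> 0 \<and> A = outer k q \<and> V = outer h v"
    then have nz: "k \<noteq> 0" "q \<noteq> 0" "v \<noteq> 0" "h \<noteq> 0" and AV: "A = outer k q" "V = outer h v"
      by auto
    \<comment> \<open>Both pairs yield \<open>(q \<bullet> x) * (h \<bullet> w) * (k \<bullet> y) *
      (v \<bullet> y)\<close>, which is symmetric in \<open>k\<close> and \<open>v\<close>.\<close>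
    have swap: "(outer v q, outer h k) \<in> fiber a phi"
      using assms(1) rank_outer_le[of v q]
      by (simp add: fiber AV outer_mult_vector vector_mult_outer mult_ac)
    show "fiber a phi = rescalings (outer k q, outer h v) \<union> rescalings (outer v q, outer h k)"
    proof
      show "rescalings (outer k q, outer h v) \<union> rescalings (outer v q, outer h k) \<subseteq> fiber a phi"
        using rescalings_subset_fiber[OF self assms(2)] rescalings_subset_fiber[OF swap assms(2)]
        by (simp add: AV)
      show "fiber a phi \<subseteq> rescalings (outer k q, outer h v) \<union> rescalings (outer v q, outer h k)"
      proof (clarify)
        fix A' V'
        assume W': "(A', V') \<in> fiber a phi"
          and no: "(A', V') \<notin> rescalings (outer v q, outer h k)"
        have eq: "((outer k q *v x) \<bullet> y) * ((w v* outer h v) \<bullet> y) = ((A' *v x) \<bullet> y) * ((w v* V') \<bullet> y)"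
          for x w y
          using W' by (simp add: fiber AV)
        have eq': "((outer v q *v x) \<bullet> y) * ((w v* outer h k) \<bullet> y) = ((A' *v x) \<bullet> y) * ((w v* V') \<bullet> y)"
          for x w y
          using eq[of x y w] by (simp add: outer_mult_vector vector_mult_outer mult_ac)
        \<comment> \<open>Testing at \<open>x = q\<close> and \<open>w = h\<close> makes the scalars
          \<open>q \<bullet> q\<close> and \<open>h \<bullet> h\<close> nonzero;
          \<open>A' *v q\<close> is then a multiple of \<open>k\<close> or of
          \<open>v\<close>.\<close>
        have nz': "outer k q *v q \<noteq> 0" "outer v q *v q \<noteq> 0"
            "h v* outer h v \<noteq> 0" "h v* outer h k \<noteq> 0"
          using nz by (simp_all add: outer_mult_vector vector_mult_outer)
        consider l where "A' *v q = l *\<^sub>R (outer k q *v q)"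
          | l where "A' *v q = l *\<^sub>R (h v* outer h v)"
          using linear_forms_mult_eq[OF nz'(1,3) eq] by blast
        then show "(A', V') \<in> rescalings (outer k q, outer h v)"
        proof cases
          case 1
          from linear_forms_family_unswapped[where f = "(*v) (outer k q)" and f' = "(*v) A'" and g = "\<lambda>w. w v* outer h v" and g' = "\<lambda>w. w v* V'",
              OF eq nz'(1) 1 nz'(3)]
          show ?thesis by (rule rescalingsI)
        next
          case 2
          \<comment> \<open>The vectors compared are \<open>(h \<bullet> h) *\<^sub>R v\<close> and
            \<open>(q \<bullet> q) *\<^sub>R v\<close>, whence the factor. Relative to the swapped
            pair the factors are now unswapped.\<close>
          then have "A' *v q = (l * (h \<bullet> h) / (q \<bullet> q)) *\<^sub>R (outer v q *v q)"
            using nz by (simp add: outer_mult_vector vector_mult_outer)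
          from linear_forms_family_unswapped[where f = "(*v) (outer v q)" and f' = "(*v) A'" and g = "\<lambda>w. w v* outer h k" and g' = "\<lambda>w. w v* V'",
              OF eq' nz'(2) this nz'(4)]
          have "(A', V') \<in> rescalings (outer v q, outer h k)" by (rule rescalingsI)
          with no show ?thesis by contradiction
        qed
      qed
    qed
  }
  show "fiber a phi = {(A', V') \<in> params a. A' = 0 \<or> V' = 0}" if "phi = (\<lambda>X. 0)"
    unfolding that fiber_def using lightning_eq_0_iff[OF assms(2)] by auto
  show "fiber a phi = rescalings (A, V)"
    if *: "\<not> (rank A = 1 \<and> rank V = 1) \<and> phi \<noteq> (\<lambda>X. 0)"
  proof
    show "rescalings (A, V) \<subseteq> fiber a phi"
      using self assms(2) by (rule rescalings_subset_fiber)
    have nz: "A \<noteq> 0" "V \<noteq> 0"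
      using * assms(4) lightning_eq_0_iff[OF assms(2)] by auto
    then obtain x0 w0 where x0: "A *v x0 \<noteq> 0" and w0: "w0 v* V \<noteq> 0"
      by (metis matrix_vector_mult_nonzero vector_matrix_mult_nonzero)
    show "fiber a phi \<subseteq> rescalings (A, V)"
    proof (clarify)
      fix A' V' assume "(A', V') \<in> fiber a phi"
      then have eq: "((A *v x) \<bullet> y) * ((w v* V) \<bullet> y) = ((A' *v x) \<bullet> y) * ((w v* V') \<bullet> y)" for x w y
        by (simp add: fiber)
      \<comment> \<open>Excludes the always-swapped alternative: the second range is that of
        \<open>transpose V\<close>, so both inclusions would make \<open>A\<close> and
        \<open>V\<close> of rank one.\<close>
      have "\<not> (range ((*v) A) \<subseteq> span {u} \<and> range (\<lambda>w. w v* V) \<subseteq> span {v})" for u v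
      proof
        assume sub: "range ((*v) A) \<subseteq> span {u} \<and> range (\<lambda>w. w v* V) \<subseteq> span {v}"
        have "transpose V \<noteq> 0"
          using nz(2) by (metis transpose_transpose transpose_0)
        then have "rank (transpose V) = 1"
          by (rule rank_eq_1_of_range_span[of _ v]) (use sub in simp)
        then show False
          using * sub rank_eq_1_of_range_span[OF nz(1), of u] by (simp add: rank_transpose)
      qed
      then obtain l where "l \<noteq> 0" "\<forall>x. A' *v x = l *\<^sub>R (A *v x)"
          "\<forall>w. w v* V' = (1 / l) *\<^sub>R (w v* V)"
        using linear_forms_family_eq[where f = "(*v) (A)" and f' = "(*v) A'" and g = "\<lambda>w. w v* V" and g' = "\<lambda>w. w v* V'",
              OF eq x0 w0] by blast
      then show "(A', V') \<in> rescalings (A, V)" by (blast intro: rescalingsI)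
    qed
  qed
qed

end
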